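(* Let $K:V\to\mathfrak g$ be an $\mathcal O$-operator on the differential 3-Lie algebra $(\mathfrak g,d_{\mathfrak g})$ with weight $\lambda$ associated to the representation $(V,\rho,d_V)$. Then $(V,[\cdot,\cdot,\cdot]_K,d_V)$ is a differential 3-Lie algebra with weight $\lambda$, where for all $u,v,w\in V$ $$[u,v,w]_K=\rho(K(u),K(v))w+\rho(K(v),K(w))u+\rho(K(w),K(u))v.$$
   Context: $k$ is a field of characteristic 0; all vector spaces are over $k$. A 3-Lie algebra is a vector space $\mathfrak g$ with a skew-symmetric trilinear bracket satisfying $[x_1,x_2,[y_1,y_2,y_3]]=[[x_1,x_2,y_1],y_2,y_3]+[y_1,[x_1,x_2,y_2],y_3]+[y_1,y_2,[x_1,x_2,y_3]]$. A differential 3-Lie algebra with weight $\lambda$ is a 3-Lie algebra with a linear map $d=d_{\mathfrak g}:\mathfrak g\to\mathfrak g$ such that $d[x_1,x_2,x_3]=[dx_1,x_2,x_3]+[x_1,dx_2,x_3]+[x_1,x_2,dx_3]+\lambda[dx_1,dx_2,x_3]+\lambda[x_1,dx_2,dx_3]+\lambda[dx_1,x_2,dx_3]+\lambda^2[dx_1,dx_2,dx_3]$. A representation of a 3-Lie algebra $\mathfrak g$ is a vector space $V$ with a skew-symmetric bilinear map $\rho:\mathfrak g\wedge\mathfrak g\to gl(V)$ such that $\rho(x_1,x_2)\rho(x_3,x_4)=\rho([x_1,x_2,x_3],x_4)+\rho(x_3,[x_1,x_2,x_4])+\rho(x_3,x_4)\rho(x_1,x_2)$ and $\rho(x_1,[x_2,x_3,x_4])=\rho(x_3,x_4)\rho(x_1,x_2)-\rho(x_2,x_4)\rho(x_1,x_3)+\rho(x_2,x_3)\rho(x_1,x_4)$.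 A representation $(V,\rho,d_V)$ of $(\mathfrak g,d)$ has in addition a linear $d_V:V\to V$ with $d_V\rho(x_1,x_2)=\rho(dx_1,x_2)+\rho(x_1,dx_2)+\lambda\rho(dx_1,dx_2)+\rho(x_1,x_2)d_V+\lambda(\rho(dx_1,x_2)+\rho(x_1,dx_2)+\lambda\rho(dx_1,dx_2))d_V$. An $\mathcal O$-operator on $(\mathfrak g,d_{\mathfrak g})$ associated to $(V,\rho,d_V)$ is a linear map $K:V\to\mathfrak g$ with $Kd_V=d_{\mathfrak g}K$ and $[K(u),K(v),K(w)]=K\big(\rho(K(u),K(v))w+\rho(K(v),K(w))u+\rho(K(w),K(u))v\big)$ for all $u,v,w\in V$. *)

theory Defs
  imports Complex_Main
begin

text \<open>
  The vector spaces are whole types with an explicit scalar multiplication over an arbitrary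
  field of characteristic 0. A map into \<open>gl(V)\<close>, the space of linear endomorphisms of \<open>V\<close>, is a
  curried function each of whose values is linear.
\<close>

locale three_Lie_algebra = vector_space scale
  for scale :: "'k::field_char_0 \<Rightarrow> 'g::ab_group_add \<Rightarrow> 'g" +
  fixes br :: "'g \<Rightarrow> 'g \<Rightarrow> 'g \<Rightarrow> 'g"
  assumes linear_br1: "Vector_Spaces.linear scale scale (\<lambda>x. br x y z)"
    and linear_br2: "Vector_Spaces.linear scale scale (\<lambda>y. br x y z)"
    and linear_br3: "Vector_Spaces.linear scale scale (\<lambda>z. br x y z)"
    \<comment> \<open>the two adjacent transpositions generate the symmetric group on three letters\<close>
    and skew_br12: "br y x z = - br x y z"
    and skew_br23: "br x z y = - br x y z"
    and fundamental_identity: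
      "br x1 x2 (br y1 y2 y3) =
         br (br x1 x2 y1) y2 y3 + br y1 (br x1 x2 y2) y3 + br y1 y2 (br x1 x2 y3)"

locale differential_three_Lie_algebra = three_Lie_algebra scale br
  for scale :: "'k::field_char_0 \<Rightarrow> 'g::ab_group_add \<Rightarrow> 'g"
    and br :: "'g \<Rightarrow> 'g \<Rightarrow> 'g \<Rightarrow> 'g" +
  fixes wt :: 'k
    and d :: "'g \<Rightarrow> 'g"
  assumes linear_d: "Vector_Spaces.linear scale scale d"
    and d_br:
      "d (br x1 x2 x3) =
         br (d x1) x2 x3 + br x1 (d x2) x3 + br x1 x2 (d x3)
         + scale wt (br (d x1) (d x2) x3)
         + scale wt (br x1 (d x2) (d x3))
         + scale wt (br (d x1) x2 (d x3))
         + scale (wt\<^sup>2) (br (d x1) (d x2) (d x3))"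

locale three_Lie_representation =
  three_Lie_algebra scale br + V: vector_space scaleV
  for scale :: "'k::field_char_0 \<Rightarrow> 'g::ab_group_add \<Rightarrow> 'g"
    and br :: "'g \<Rightarrow> 'g \<Rightarrow> 'g \<Rightarrow> 'g"
    and scaleV :: "'k \<Rightarrow> 'v::ab_group_add \<Rightarrow> 'v" +
  fixes \<rho> :: "'g \<Rightarrow> 'g \<Rightarrow> 'v \<Rightarrow> 'v"
  assumes linear_rho: "Vector_Spaces.linear scaleV scaleV (\<rho> x y)"
    and linear_rho1: "Vector_Spaces.linear scale scaleV (\<lambda>x. \<rho> x y v)"
    and linear_rho2: "Vector_Spaces.linear scale scaleV (\<lambda>y. \<rho> x y v)"
    and skew_rho: "\<rho> y x v = - \<rho> x y v"
    and rho_comp: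
      "\<rho> x1 x2 (\<rho> x3 x4 v) =
         \<rho> (br x1 x2 x3) x4 v + \<rho> x3 (br x1 x2 x4) v + \<rho> x3 x4 (\<rho> x1 x2 v)"
    and rho_br:
      "\<rho> x1 (br x2 x3 x4) v =
         \<rho> x3 x4 (\<rho> x1 x2 v) - \<rho> x2 x4 (\<rho> x1 x3 v) + \<rho> x2 x3 (\<rho> x1 x4 v)"

locale differential_three_Lie_representation =
  differential_three_Lie_algebra scale br wt d + three_Lie_representation scale br scaleV \<rho>
  for scale :: "'k::field_char_0 \<Rightarrow> 'g::ab_group_add \<Rightarrow> 'g"
    and br :: "'g \<Rightarrow> 'g \<Rightarrow> 'g \<Rightarrow> 'g"
    and wt :: 'k
    and d :: "'g \<Rightarrow> 'g"
    and scaleV :: "'k \<Rightarrow> 'v::ab_group_add \<Rightarrow> 'v"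
    and \<rho> :: "'g \<Rightarrow> 'g \<Rightarrow> 'v \<Rightarrow> 'v" +
  fixes dV :: "'v \<Rightarrow> 'v"
  assumes linear_dV: "Vector_Spaces.linear scaleV scaleV dV"
    and dV_rho:
      "dV (\<rho> x1 x2 v) =
         \<rho> (d x1) x2 v + \<rho> x1 (d x2) v + scaleV wt (\<rho> (d x1) (d x2) v)
         + \<rho> x1 x2 (dV v)
         + scaleV wt (\<rho> (d x1) x2 (dV v) + \<rho> x1 (d x2) (dV v)
                     + scaleV wt (\<rho> (d x1) (d x2) (dV v)))"

definition induced_bracket ::
    "('g \<Rightarrow> 'g \<Rightarrow> 'v \<Rightarrow> 'v) \<Rightarrow> ('v \<Rightarrow> 'g) \<Rightarrow> 'v \<Rightarrow> 'v \<Rightarrow> 'v \<Rightarrow> 'v::ab_group_add" where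
  "induced_bracket \<rho> K u v w = \<rho> (K u) (K v) w + \<rho> (K v) (K w) u + \<rho> (K w) (K u) v"

locale O_operator = differential_three_Lie_representation scale br wt d scaleV \<rho> dV
  for scale :: "'k::field_char_0 \<Rightarrow> 'g::ab_group_add \<Rightarrow> 'g"
    and br :: "'g \<Rightarrow> 'g \<Rightarrow> 'g \<Rightarrow> 'g"
    and wt :: 'k
    and d :: "'g \<Rightarrow> 'g"
    and scaleV :: "'k \<Rightarrow> 'v::ab_group_add \<Rightarrow> 'v"
    and \<rho> :: "'g \<Rightarrow> 'g \<Rightarrow> 'v \<Rightarrow> 'v"
    and dV :: "'v \<Rightarrow> 'v" +
  fixes K :: "'v \<Rightarrow> 'g"
  assumes linear_K: "Vector_Spaces.linear scaleV scale K"
    and K_dV: "K (dV v) = d (K v)"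
    and br_K:
      "br (K u) (K v) (K w) =
         K (\<rho> (K u) (K v) w + \<rho> (K v) (K w) u + \<rho> (K w) (K u) v)"

end

theory Submission imports Defs begin

text \<open>
  The \<open>\<O>\<close>-operator equation says that \<open>K\<close> carries the induced bracket to the bracket of \<open>\<gg>\<close>.
  Hence both sides of the fundamental identity expand into terms \<open>\<rho>(\<cdot>,\<cdot>)\<close> applied to one of
  \<open>u\<^sub>1, u\<^sub>2, v\<^sub>1, v\<^sub>2, v\<^sub>3\<close>: those in the \<open>v\<^sub>i\<close> agree by the first representation axiom, those in the
  \<open>u\<^sub>j\<close> by the second.
\<close>

context O_operator
begin

abbreviation brK :: "'v \<Rightarrow> 'v \<Rightarrow> 'v \<Rightarrow> 'v" where
  "brK \<equiv> induced_bracket \<rho> K"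

lemma K_induced_bracket: "K (brK u v w) = br (K u) (K v) (K w)"
  by (simp add: induced_bracket_def br_K)

lemmas K_add = module_hom.add[OF linear_K[folded module_hom_iff_linear]]
  and K_scale = module_hom.scale[OF linear_K[folded module_hom_iff_linear]]
  and rho_add = module_hom.add[OF linear_rho[folded module_hom_iff_linear]]
  and rho_scale = module_hom.scale[OF linear_rho[folded module_hom_iff_linear]]
  and rho_add1 = module_hom.add[OF linear_rho1[folded module_hom_iff_linear]]
  and rho_scale1 = module_hom.scale[OF linear_rho1[folded module_hom_iff_linear]]
  and rho_add2 = module_hom.add[OF linear_rho2[folded module_hom_iff_linear]]
  and rho_scale2 = module_hom.scale[OF linear_rho2[folded module_hom_iff_linear]]

text \<open>A cyclic shift only permutes the three summands. This carries linearity in the first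
  slot to the other two, and skewness in the first pair to the second pair.\<close>

lemma induced_bracket_cyclic: "brK v w u = brK u v w"
  by (simp add: induced_bracket_def add_ac)

lemma linear_induced_bracket: "Vector_Spaces.linear scaleV scaleV (\<lambda>u. brK u v w)"
  unfolding Vector_Spaces.linear_iff induced_bracket_def
  by (simp add: V.vector_space_axioms K_add K_scale rho_add rho_scale rho_add1 rho_scale1
      rho_add2 rho_scale2 V.scale_right_distrib algebra_simps)

lemma induced_bracket_skew: "brK v u w = - brK u v w"
  unfolding induced_bracket_def
  using skew_rho[of "K u" "K v" w] skew_rho[of "K v" "K w" u] skew_rho[of "K w" "K u" v]
  by simp

lemma induced_bracket_fundamental_identity:
  "brK u1 u2 (brK v1 v2 v3) =
     brK (brK u1 u2 v1) v2 v3 + brK v1 (brK u1 u2 v2) v3 + brK v1 v2 (brK u1 u2 v3)"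
proof -
  let ?a = "K u1" and ?b = "K u2" and ?x = "K v1" and ?y = "K v2" and ?z = "K v3"
  have comp: "\<rho> ?a ?b (brK v1 v2 v3) =
      \<rho> (br ?a ?b ?x) ?y v3 + \<rho> ?x (br ?a ?b ?y) v3 + \<rho> ?x ?y (\<rho> ?a ?b v3)
    + (\<rho> (br ?a ?b ?y) ?z v1 + \<rho> ?y (br ?a ?b ?z) v1 + \<rho> ?y ?z (\<rho> ?a ?b v1))
    + (\<rho> (br ?a ?b ?z) ?x v2 + \<rho> ?z (br ?a ?b ?x) v2 + \<rho> ?z ?x (\<rho> ?a ?b v2))"
    unfolding induced_bracket_def rho_add by (simp only: rho_comp[of ?a ?b])
  \<comment> \<open>The second representation axiom in cyclic form: skewness turns the middle term
    \<open>- \<rho> ?x ?z\<close> into \<open>\<rho> ?z ?x\<close>.\<close>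
  have br: "\<rho> c (br ?x ?y ?z) v = \<rho> ?y ?z (\<rho> c ?x v) + \<rho> ?z ?x (\<rho> c ?y v) + \<rho> ?x ?y (\<rho> c ?z v)"
    for c v
    by (simp add: rho_br skew_rho[of ?z ?x])
  \<comment> \<open>Skewness moves \<open>?a\<close> to the first slot on both sides, and the signs
    cancel by linearity.\<close>
  have u2: "\<rho> (br ?x ?y ?z) ?a u2 = \<rho> ?y ?z (\<rho> ?x ?a u2) + \<rho> ?z ?x (\<rho> ?y ?a u2) + \<rho> ?x ?y (\<rho> ?z ?a u2)"
    by (simp add: skew_rho[of _ ?a] br module_hom.neg[OF linear_rho[folded module_hom_iff_linear]])
  have "brK u1 u2 (brK v1 v2 v3) =
      \<rho> ?a ?b (brK v1 v2 v3) + \<rho> ?b (br ?x ?y ?z) u1 + \<rho> (br ?x ?y ?z) ?a u2"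
    by (subst induced_bracket_def) (simp only: K_induced_bracket)
  \<comment> \<open>Of the fifteen terms, the nine with nested \<open>\<rho>\<close> are collected
    by outer pair. For instance, \<open>\<rho> ?y ?z\<close> is applied to
    \<open>\<rho> ?a ?b v1\<close>, \<open>\<rho> ?b ?x u1\<close> and
    \<open>\<rho> ?x ?a u2\<close>, whose sum is \<open>brK u1 u2 v1\<close>.\<close>
  also have "\<dots> = (\<rho> (br ?a ?b ?x) ?y v3 + \<rho> ?y ?z (brK u1 u2 v1) + \<rho> ?z (br ?a ?b ?x) v2)
    + (\<rho> ?x (br ?a ?b ?y) v3 + \<rho> (br ?a ?b ?y) ?z v1 + \<rho> ?z ?x (brK u1 u2 v2))
    + (\<rho> ?x ?y (brK u1 u2 v3) + \<rho> ?y (br ?a ?b ?z) v1 + \<rho> (br ?a ?b ?z) ?x v2)"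
    unfolding comp u2 br[of ?b] by (simp add: induced_bracket_def rho_add add_ac)
  also have "\<dots> = brK (brK u1 u2 v1) v2 v3 + brK v1 (brK u1 u2 v2) v3 + brK v1 v2 (brK u1 u2 v3)"
    unfolding induced_bracket_def[of \<rho> K "brK u1 u2 v1"]
      induced_bracket_def[of \<rho> K v1 "brK u1 u2 v2"]
      induced_bracket_def[of \<rho> K v1 v2 "brK u1 u2 v3"] K_induced_bracket ..
  finally show ?thesis .
qed

text \<open>Since \<open>K\<close> intertwines \<open>dV\<close> and \<open>d\<close>, compatibility
  of \<open>dV\<close> with \<open>\<rho>\<close> turns each of the three summands into seven terms,
  one for each nonempty subset of \<open>u\<close>, \<open>v\<close>, \<open>w\<close> that gets
  differentiated. Collecting by subset gives the seven brackets; the weight has exponent one less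
  than the size of the subset.\<close>

lemma dV_induced_bracket:
  "dV (brK u v w) =
     brK (dV u) v w + brK u (dV v) w + brK u v (dV w)
     + scaleV wt (brK (dV u) (dV v) w)
     + scaleV wt (brK u (dV v) (dV w))
     + scaleV wt (brK (dV u) v (dV w))
     + scaleV (wt\<^sup>2) (brK (dV u) (dV v) (dV w))"
  unfolding induced_bracket_def K_dV module_hom.add[OF linear_dV[folded module_hom_iff_linear]] dV_rho
  by (simp add: V.scale_right_distrib power2_eq_square add_ac)

lemma differential_three_Lie_algebra_induced_bracket:
  "differential_three_Lie_algebra scaleV brK wt dV"
proof (intro differential_three_Lie_algebra.intro three_Lie_algebra.intro
    three_Lie_algebra_axioms.intro differential_three_Lie_algebra_axioms.intro)
  fix u v w
  show "Vector_Spaces.linear scaleV scaleV (\<lambda>x. brK x v w)"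
    by (rule linear_induced_bracket)
  show "Vector_Spaces.linear scaleV scaleV (\<lambda>y. brK u y w)"
    using linear_induced_bracket[of w u] by (simp only: induced_bracket_cyclic[of _ w u])
  show "Vector_Spaces.linear scaleV scaleV (\<lambda>z. brK u v z)"
    using linear_induced_bracket[of u v] by (simp only: induced_bracket_cyclic[of u v, symmetric])
  show "brK v u w = - brK u v w"
    by (rule induced_bracket_skew)
  show "brK u w v = - brK u v w"
    using induced_bracket_skew[of w v u] by (simp only: induced_bracket_cyclic[of _ _ u])
qed (rule V.vector_space_axioms induced_bracket_fundamental_identity linear_dV dV_induced_bracket)+

end

theorem proposition4p6:
  fixes scale :: "'k::field_char_0 \<Rightarrow> 'g::ab_group_add \<Rightarrow> 'g"
    and br :: "'g \<Rightarrow> 'g \<Rightarrow> 'g \<Rightarrow> 'g"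
    and wt :: 'k
    and d :: "'g \<Rightarrow> 'g"
    and scaleV :: "'k \<Rightarrow> 'v::ab_group_add \<Rightarrow> 'v"
    and \<rho> :: "'g \<Rightarrow> 'g \<Rightarrow> 'v \<Rightarrow> 'v"
    and dV :: "'v \<Rightarrow> 'v"
    and K :: "'v \<Rightarrow> 'g"
  assumes "differential_three_Lie_algebra scale br wt d"
    and "differential_three_Lie_representation scale br wt d scaleV \<rho> dV"
    and "O_operator scale br wt d scaleV \<rho> dV K"
  shows "differential_three_Lie_algebra scaleV (induced_bracket \<rho> K) wt dV"
  using assms(3) by (rule O_operator.differential_three_Lie_algebra_induced_bracket)

end
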